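(* Let $S=\{0=s_0<s_1<\dots<s_n\}$ be a compact distance set with block decomposition $S=\{0\}\cup B_1\cup\dots\cup B_k$, $k\ge2$. Let $S^+=S\setminus B_1$ and let $\mathcal{L}$ be a finite $S^+$-metric space. Then $\mathbf{Met}_{S,\mathcal{L}}^{\mathit{fin}}$ is a Fraïssé age with respect to $\mathbf{Met}_{S,\mathcal{L}}$.
   Context: For $S=\{0=s_0<\dots<s_n\}$, $s_i$ is a jump number if $i=n$ or $2s_i<s_{i+1}$; for consecutive jump numbers $s_i<s_j$, $S\cap(s_i,s_j]$ is a block, and $\{0\}$ is the trivial block; blocks are enumerated $\{0\},B_1,\dots,B_k$ increasingly. $x\approx y$ iff $x,y$ are in the same block. $S$ is a compact distance set if for all $x,y\in S\setminus\{0\}$: $|x-y|\le s_1$ iff $x\approx y$. $\mathbf{Met}_S$ is the class of finite and countably infinite metric spaces with distances in $S$, with isometric embeddings. For $\mathcal{M}=(M,d)\in\mathbf{Met}_S$, $x\sim y$ iff $d(x,y)\in\{0\}\cup B_1$ (an equivalence relation). A finite $S^+$-metric space $\mathcal{L}$ spans $\mathcal{M}\in\mathbf{Met}_S$ if $|M/{\sim}|=|L|$ and the partition $M/{\sim}=\{A_1,\dots,A_m\}$ has a transversal $a_i\in A_i$ such that the subspace on $\{a_1,\dots,a_m\}$ is isometric to $\mathcal{L}$. $\mathbf{Met}_{S,\mathcal{L}}$ is the full subcategory of $\mathbf{Met}_S$ of all $\mathcal{M}$ spanned by $\mathcal{L}$, and $\mathbf{Met}_{S,\mathcal{L}}^{\mathit{fin}}$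 its finite members. A class $\mathbf{K}$ of finite structures is an age with respect to an ambient class $\mathbf{A}$ if there is a countably infinite $\mathcal{F}\in\mathbf{A}$ such that $\mathbf{K}$ is the class of finite members of $\mathbf{A}$ embeddable in $\mathcal{F}$; it is a Fraïssé age if it additionally has the amalgamation property: for $\mathcal{A},\mathcal{B},\mathcal{C}\in\mathbf{K}$ and embeddings $f:\mathcal{A}\hookrightarrow\mathcal{B}$, $g:\mathcal{A}\hookrightarrow\mathcal{C}$ there exist $\mathcal{D}\in\mathbf{K}$ and embeddings $f':\mathcal{B}\hookrightarrow\mathcal{D}$, $g':\mathcal{C}\hookrightarrow\mathcal{D}$ with $f'\circ f=g'\circ g$. *)

theory Defs
  imports "HOL-Analysis.Analysis" "HOL-Library.Equipollence"
begin

definition distance_set :: "real set \<Rightarrow> bool" where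
  "distance_set S \<longleftrightarrow> finite S \<and> 0 \<in> S \<and> (\<forall>x\<in>S. 0 \<le> x)"

text \<open>For \<open>S = {0 = s\<^sub>0 < \<dots> < s\<^sub>n}\<close>, \<open>dist_val S i\<close> is \<open>s\<^sub>i\<close> (meaningful for \<open>i \<le> n = card S - 1\<close>).\<close>

definition dist_val :: "real set \<Rightarrow> nat \<Rightarrow> real" where
  "dist_val S i = sorted_list_of_set S ! i"

definition jump_numbers :: "real set \<Rightarrow> real set" where
  "jump_numbers S = {dist_val S i | i.
     i \<le> card S - 1 \<and> (i = card S - 1 \<or> 2 * dist_val S i < dist_val S (i + 1))}"

definition jump :: "real set \<Rightarrow> nat \<Rightarrow> real" where
  "jump S i = sorted_list_of_set (jump_numbers S) ! i"

text \<open>The smallest jump number is always \<open>0\<close>, so the blocks are \<open>{0}, B\<^sub>1, \<dots>, B\<^sub>k\<close>, where \<open>k + 1\<close> is the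
  number of jump numbers and \<open>B\<^sub>i\<close> lies between the consecutive jump numbers with indices
  \<open>i - 1\<close> and \<open>i\<close>.\<close>

fun block :: "real set \<Rightarrow> nat \<Rightarrow> real set" where
  "block S 0 = {0}"
| "block S (Suc i) = S \<inter> {jump S i <.. jump S (Suc i)}"

definition num_blocks :: "real set \<Rightarrow> nat" where
  "num_blocks S = card (jump_numbers S) - 1"

definition same_block :: "real set \<Rightarrow> real \<Rightarrow> real \<Rightarrow> bool" where
  "same_block S x y \<longleftrightarrow> (\<exists>i\<le>num_blocks S. x \<in> block S i \<and> y \<in> block S i)"

definition compact_distance_set :: "real set \<Rightarrow> bool" where
  "compact_distance_set S \<longleftrightarrow> distance_set S \<and>
     (\<forall>x\<in>S - {0}. \<forall>y\<in>S - {0}. \<bar>x - y\<bar> \<le> dist_val S 1 \<longleftrightarrow> same_block S x y)"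

definition has_distances_in :: "'a metric \<Rightarrow> real set \<Rightarrow> bool" where
  "has_distances_in X S \<longleftrightarrow> (\<forall>x\<in>mspace X. \<forall>y\<in>mspace X. mdist X x y \<in> S)"

definition isometric_embedding :: "'a metric \<Rightarrow> 'b metric \<Rightarrow> ('a \<Rightarrow> 'b) \<Rightarrow> bool" where
  "isometric_embedding X Y f \<longleftrightarrow> f \<in> mspace X \<rightarrow> mspace Y \<and>
     (\<forall>x\<in>mspace X. \<forall>y\<in>mspace X. mdist Y (f x) (f y) = mdist X x y)"

definition embeddable :: "'a metric \<Rightarrow> 'b metric \<Rightarrow> bool" where
  "embeddable X Y \<longleftrightarrow> (\<exists>f. isometric_embedding X Y f)"

definition isometric :: "'a metric \<Rightarrow> 'b metric \<Rightarrow> bool" where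
  "isometric X Y \<longleftrightarrow> (\<exists>f. isometric_embedding X Y f \<and> f ` mspace X = mspace Y)"

definition Met :: "real set \<Rightarrow> 'a metric set" where
  "Met S = {X. countable (mspace X) \<and> has_distances_in X S}"

definition sim_rel :: "real set \<Rightarrow> 'a metric \<Rightarrow> ('a \<times> 'a) set" where
  "sim_rel S X = {(x, y). x \<in> mspace X \<and> y \<in> mspace X \<and> mdist X x y \<in> {0} \<union> block S 1}"

definition spans :: "real set \<Rightarrow> 'b metric \<Rightarrow> 'a metric \<Rightarrow> bool" where
  "spans S L X \<longleftrightarrow> eqpoll (mspace X // sim_rel S X) (mspace L) \<and>
     (\<exists>T\<subseteq>mspace X. (\<forall>A\<in>mspace X // sim_rel S X. \<exists>!a. a \<in> T \<inter> A) \<and>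
        isometric (submetric X T) L)"

definition Met_spanned :: "real set \<Rightarrow> 'b metric \<Rightarrow> 'a metric set" where
  "Met_spanned S L = {X \<in> Met S. spans S L X}"

definition Met_spanned_fin :: "real set \<Rightarrow> 'b metric \<Rightarrow> 'a metric set" where
  "Met_spanned_fin S L = {X \<in> Met_spanned S L. finite (mspace X)}"

text \<open>A class of metric spaces is represented by the set of its members whose points are drawn from a
  fixed type \<open>'a\<close>. If \<open>'a\<close> is infinite, every countable metric space has an isometric copy there,
  so nothing is lost for isometry-closed classes of countable spaces.\<close>

definition is_age :: "'a metric set \<Rightarrow> 'a metric set \<Rightarrow> bool" where
  "is_age K \<A> \<longleftrightarrow> (\<exists>F\<in>\<A>. countable (mspace F) \<and> infinite (mspace F) \<and>
     K = {X \<in> \<A>. finite (mspace X) \<and> embeddable X F})"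

definition amalgamation_property :: "'a metric set \<Rightarrow> bool" where
  "amalgamation_property K \<longleftrightarrow>
     (\<forall>A\<in>K. \<forall>B\<in>K. \<forall>C\<in>K. \<forall>f g. isometric_embedding A B f \<longrightarrow> isometric_embedding A C g \<longrightarrow>
        (\<exists>D\<in>K. \<exists>f' g'. isometric_embedding B D f' \<and> isometric_embedding C D g' \<and>
           (\<forall>a\<in>mspace A. f' (f a) = g' (g a))))"

definition fraisse_age :: "'a metric set \<Rightarrow> 'a metric set \<Rightarrow> bool" where
  "fraisse_age K \<A> \<longleftrightarrow> is_age K \<A> \<and> amalgamation_property K"

end

theory Submission
  imports Defs
begin

text \<open>
  In a compact distance set, any two nonzero distances in the same block differ by at most the
  least nonzero distance \<open>s\<^sub>1\<close>, and the larger of two distances in different blocks exceeds twice the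
  smaller one. Hence whether three nonzero distances satisfy the triangle inequality depends only on
  their blocks. A space spanned by \<open>L\<close> is therefore the same as a set \<open>M\<close> with a map \<open>\<rho>\<close> to \<open>L\<close>:
  distances inside a fibre range freely over \<open>B\<^sub>1\<close>, those between the fibres of \<open>l \<noteq> l'\<close> range
  freely over the block of \<open>d(l, l')\<close>, and some section of \<open>\<rho>\<close> is isometric.

  Spaces can thus be glued by taking \<open>s\<^sub>1\<close> for the undetermined distances inside a fibre and
  \<open>d(l, l')\<close> for those between fibres. For the amalgamation property one glues along the common
  subspace, which meets every fibre because \<open>L\<close> is finite. For the age one glues disjointly the
  countably many finite spaces in the class.
\<close>

section \<open>Blocks of a compact distance set\<close>

lemma dist_val_in: "finite S \<Longrightarrow> i < card S \<Longrightarrow> dist_val S i \<in> S"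
  unfolding dist_val_def by (metis length_sorted_list_of_set nth_mem set_sorted_list_of_set)

lemma dist_val_less: "i < j \<Longrightarrow> j < card S \<Longrightarrow> dist_val S i < dist_val S j"
  unfolding dist_val_def
  using sorted_wrt_nth_less[OF strict_sorted_list_of_set] by (metis length_sorted_list_of_set)

lemma dist_val_mono: "i \<le> j \<Longrightarrow> j < card S \<Longrightarrow> dist_val S i \<le> dist_val S j"
  using dist_val_less[of i j S] by (cases "i = j") auto

lemma dist_val_surj:
  assumes "finite S" "x \<in> S"
  obtains i where "i < card S" "x = dist_val S i"
  using assms unfolding dist_val_def
  by (metis in_set_conv_nth length_sorted_list_of_set set_sorted_list_of_set)

text \<open>Lets the facts about \<open>dist_val\<close> be reused for the enumeration of the jump
  numbers.\<close>

lemma jump_eq_dist_val: "jump S = dist_val (jump_numbers S)"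
  by (simp add: jump_def dist_val_def fun_eq_iff)

text \<open>A nontrivial block forces a second jump number, so \<open>s1\<close> is a positive
  element of S and \<open>B1\<close> is inhabited.\<close>

locale compact_blocks =
  fixes S :: "real set"
  assumes compact: "compact_distance_set S" and num_blocks: "num_blocks S \<ge> 1"
begin

abbreviation s1 :: real where "s1 \<equiv> dist_val S 1"

abbreviation same :: "real \<Rightarrow> real \<Rightarrow> bool" (infix \<open>\<approx>\<^sub>S\<close> 50) where "x \<approx>\<^sub>S y \<equiv> same_block S x y"

abbreviation B1 :: "real set" where "B1 \<equiv> block S 1"

lemma finite_S: "finite S" and zero_in: "0 \<in> S" and nonneg: "x \<in> S \<Longrightarrow> 0 \<le> x"
  using compact by (auto simp: compact_distance_set_def distance_set_def)

section \<open>The least nonzero distance and the jump numbers\<close>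

lemma card_pos: "card S > 0"
  using finite_S zero_in by (auto simp: card_gt_0_iff)

lemma dist_val_0: "dist_val S 0 = 0"
proof -
  obtain i where i: "i < card S" "0 = dist_val S i"
    using dist_val_surj[OF finite_S zero_in] by blast
  then have "dist_val S 0 \<le> 0"
    using dist_val_mono[of 0 i S] by simp
  then show ?thesis
    using nonneg[OF dist_val_in[OF finite_S card_pos]] by simp
qed

lemma jump_numbers_subset: "jump_numbers S \<subseteq> S"
  unfolding jump_numbers_def using dist_val_in[OF finite_S] card_pos by fastforce

lemma finite_jump_numbers: "finite (jump_numbers S)"
  using jump_numbers_subset finite_S finite_subset by blast

lemma two_le_card_jump_numbers: "2 \<le> card (jump_numbers S)"
  using num_blocks by (simp add: num_blocks_def)

lemma two_le_card: "2 \<le> card S"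
  using two_le_card_jump_numbers card_mono[OF finite_S jump_numbers_subset] by linarith

lemma s1_in: "s1 \<in> S" and s1_pos: "0 < s1"
  using dist_val_in[OF finite_S, of 1] dist_val_less[of 0 1 S] two_le_card dist_val_0 by auto

lemma s1_le:
  assumes "x \<in> S" "x \<noteq> 0"
  shows "s1 \<le> x"
proof -
  obtain i where i: "i < card S" "x = dist_val S i"
    using dist_val_surj[OF finite_S assms(1)] by blast
  then have "1 \<le> i"
    using assms(2) dist_val_0 by (cases i) auto
  then show ?thesis
    using dist_val_mono i by blast
qed

lemma zero_jump_number: "0 \<in> jump_numbers S"
  unfolding jump_numbers_def using dist_val_0 s1_pos by force

lemma top_jump_number: "dist_val S (card S - 1) \<in> jump_numbers S"
  unfolding jump_numbers_def by blast

text \<open>The definition compares a jump number with its successor in S only; every larger element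
  of S is at least that successor.\<close>

lemma double_jump_less:
  assumes "a \<in> jump_numbers S" "y \<in> S" "a < y"
  shows "2 * a < y"
proof -
  obtain i where i: "a = dist_val S i" "i \<le> card S - 1"
      "i = card S - 1 \<or> 2 * dist_val S i < dist_val S (i + 1)"
    using assms(1) unfolding jump_numbers_def by blast
  obtain j where j: "j < card S" "y = dist_val S j"
    using dist_val_surj[OF finite_S assms(2)] by blast
  have "i < j"
  proof (rule ccontr)
    assume "\<not> i < j"
    then have "y \<le> a"
      using dist_val_mono[of j i S] i(1,2) j card_pos by simp
    then show False
      using assms(3) by simp
  qed
  then have "2 * a < dist_val S (i + 1)" "dist_val S (i + 1) \<le> y"
    using i j dist_val_mono[of "i + 1" j S] by auto
  then show ?thesis by simp
qed

lemma jump_in: "i \<le> num_blocks S \<Longrightarrow> jump S i \<in> jump_numbers S"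
  unfolding jump_eq_dist_val num_blocks_def
  using dist_val_in[OF finite_jump_numbers] two_le_card_jump_numbers by simp

lemma jump_mono: "i \<le> j \<Longrightarrow> j \<le> num_blocks S \<Longrightarrow> jump S i \<le> jump S j"
  unfolding jump_eq_dist_val num_blocks_def
  using dist_val_mono two_le_card_jump_numbers by simp

lemma jump_0: "jump S 0 = 0"
proof -
  obtain i where i: "i < card (jump_numbers S)" "0 = jump S i"
    unfolding jump_eq_dist_val using dist_val_surj[OF finite_jump_numbers zero_jump_number] by blast
  then have "jump S 0 \<le> 0"
    using jump_mono[of 0 i] by (simp add: num_blocks_def)
  then show ?thesis
    using nonneg jump_in[of 0] jump_numbers_subset by force
qed

section \<open>The partition of S into blocks\<close>

lemma block_subset: "block S i \<subseteq> S"
  using zero_in by (cases i) auto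

lemma same_in: "x \<approx>\<^sub>S y \<Longrightarrow> x \<in> S \<and> y \<in> S"
  unfolding same_block_def using block_subset by blast

lemma block_le_jump: "x \<in> block S i \<Longrightarrow> x \<le> jump S i"
  by (cases i) (auto simp: jump_0)

text \<open>The jump number just before block j separates the two: it bounds block i from above and
  lies strictly below block j.\<close>

lemma block_disjoint_less:
  assumes "i < j" "j \<le> num_blocks S" "x \<in> block S i"
  shows "x \<notin> block S j"
proof
  obtain k where k: "j = Suc k"
    using assms(1) by (cases j) auto
  assume "x \<in> block S j"
  then have "jump S k < x"
    using k by simp
  moreover have "x \<le> jump S k"
    using block_le_jump[OF assms(3)] jump_mono[of i k] assms(1,2) k by simp
  ultimately show False by simp
qed

lemma block_unique:
  "x \<in> block S i \<Longrightarrow> x \<in> block S j \<Longrightarrow> i \<le> num_blocks S \<Longrightarrow> j \<le> num_blocks S \<Longrightarrow> i = j"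
  using block_disjoint_less by (meson linorder_neqE_nat)

lemma same_sym: "x \<approx>\<^sub>S y \<Longrightarrow> y \<approx>\<^sub>S x"
  by (auto simp: same_block_def)

lemma same_trans [trans]: "x \<approx>\<^sub>S y \<Longrightarrow> y \<approx>\<^sub>S z \<Longrightarrow> x \<approx>\<^sub>S z"
  unfolding same_block_def using block_unique by blast

text \<open>The largest element of S is a jump number, so some jump number is at least x; the least
  index of such a jump number is the index of the block.\<close>

lemma in_some_block:
  assumes "x \<in> S"
  obtains i where "i \<le> num_blocks S" "x \<in> block S i"
proof -
  obtain j where j: "j < card S" "x = dist_val S j"
    using dist_val_surj[OF finite_S assms] by blast
  obtain k where k: "k < card (jump_numbers S)" "dist_val S (card S - 1) = jump S k"
    unfolding jump_eq_dist_val using dist_val_surj[OF finite_jump_numbers top_jump_number] by blast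
  have "x \<le> jump S k"
    using dist_val_mono[of j "card S - 1" S] j k(2) by simp
  define i where "i = (LEAST i. x \<le> jump S i)"
  have xi: "x \<le> jump S i" and ik: "i \<le> k"
    unfolding i_def using \<open>x \<le> jump S k\<close> by (rule LeastI, rule Least_le)
  have "x \<in> block S i"
  proof (cases i)
    case 0
    then show ?thesis
      using xi jump_0 nonneg[OF assms] by simp
  next
    case (Suc m)
    then have "\<not> x \<le> jump S m"
      unfolding i_def by (metis lessI not_less_Least)
    then show ?thesis
      using Suc xi assms by simp
  qed
  moreover have "i \<le> num_blocks S"
    using ik k(1) by (simp add: num_blocks_def)
  ultimately show thesis
    using that by blast
qed

lemma same_refl: "x \<in> S \<Longrightarrow> x \<approx>\<^sub>S x"
  unfolding same_block_def using in_some_block by blast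

lemma same_0_iff: "0 \<approx>\<^sub>S y \<longleftrightarrow> y = 0"
proof
  assume "0 \<approx>\<^sub>S y"
  then obtain i where i: "i \<le> num_blocks S" "0 \<in> block S i" "y \<in> block S i"
    by (auto simp: same_block_def)
  have "i = 0"
    using block_unique[OF i(2) _ i(1), of 0] by simp
  then show "y = 0"
    using i(3) by simp
qed (simp add: same_refl zero_in)

lemma same_nonzero: "x \<approx>\<^sub>S y \<Longrightarrow> y \<noteq> 0 \<Longrightarrow> x \<noteq> 0"
  using same_0_iff by blast

lemma s1_in_B1: "s1 \<in> B1"
proof -
  have "jump S 0 < jump S 1"
    unfolding jump_eq_dist_val using dist_val_less[of 0 1] two_le_card_jump_numbers by simp
  then have "s1 \<le> jump S 1"
    using jump_0 jump_in[of 1] num_blocks jump_numbers_subset s1_le by force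
  then show ?thesis
    using s1_in s1_pos jump_0 by simp
qed

lemma B1_iff: "x \<in> B1 \<longleftrightarrow> x \<approx>\<^sub>S s1"
  unfolding same_block_def using s1_in_B1 num_blocks block_unique by blast

section \<open>Compactness and the triangle inequality\<close>

lemma compact_iff:
  "x \<in> S \<Longrightarrow> x \<noteq> 0 \<Longrightarrow> y \<in> S \<Longrightarrow> y \<noteq> 0 \<Longrightarrow> \<bar>x - y\<bar> \<le> s1 \<longleftrightarrow> x \<approx>\<^sub>S y"
  using compact unfolding compact_distance_set_def by blast

lemma same_close:
  assumes "x \<approx>\<^sub>S y" "y \<noteq> 0"
  shows "\<bar>x - y\<bar> \<le> s1"
  using assms same_in same_nonzero compact_iff by meson

text \<open>Since y is above x but outside its block, y exceeds the jump number that ends this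
  block, hence also twice that number.\<close>

lemma double_less:
  assumes "x \<in> S" "y \<in> S" "\<not> x \<approx>\<^sub>S y" "x < y"
  shows "2 * x < y"
proof -
  obtain i where i: "i \<le> num_blocks S" "x \<in> block S i"
    using in_some_block[OF assms(1)] by blast
  have "y \<notin> block S i"
    using i assms(3) by (auto simp: same_block_def)
  then have "jump S i < y"
    using i(2) assms by (cases i) (auto simp: jump_0)
  then have "2 * jump S i < y"
    using double_jump_less jump_in i(1) assms(2) by blast
  then show ?thesis
    using block_le_jump[OF i(2)] by simp
qed

text \<open>The upper bound is compactness: x and \<open>s1\<close> share a block, so they differ by
  at most \<open>s1\<close>.\<close>

lemma B1_bounds:
  assumes "x \<in> B1"
  shows "x \<in> S" "x \<noteq> 0" "s1 \<le> x" "x \<le> 2 * s1"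
proof -
  have x: "x \<approx>\<^sub>S s1"
    using assms B1_iff by blast
  show "x \<in> S" "x \<noteq> 0"
    using x same_in same_nonzero s1_pos by auto
  then show "s1 \<le> x"
    using s1_le by blast
  show "x \<le> 2 * s1"
    using same_close[OF x] s1_pos by simp
qed

lemma double_B1_less:
  assumes "x \<in> {0} \<union> B1" "y \<in> S" "y \<notin> {0} \<union> B1"
  shows "2 * x < y"
proof (cases "x = 0")
  case True
  then show ?thesis
    using assms nonneg[of y] by auto
next
  case False
  then have x: "x \<in> B1"
    using assms by blast
  have "\<not> x \<approx>\<^sub>S y"
    using x assms(3) B1_iff same_sym same_trans by blast
  \<comment> \<open>Otherwise y would be below x in another block, giving \<open>2 * y < x\<close>
    and \<open>x \<le> 2 * s1\<close>, against \<open>s1 \<le> y\<close>.\<close>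
  moreover have "x < y"
  proof (rule ccontr)
    assume "\<not> x < y"
    then have "y \<noteq> x" "y \<le> x"
      using x assms by auto
    then have "2 * y < x"
      using double_less[of y x] \<open>\<not> x \<approx>\<^sub>S y\<close> same_sym assms B1_bounds(1)[OF x] by fastforce
    then show False
      using B1_bounds(4)[OF x] s1_le[OF assms(2)] assms(3) by simp
  qed
  ultimately show ?thesis
    using double_less B1_bounds(1)[OF x] assms(2) by blast
qed

text \<open>If the primed inequality fails, p' and q' are both smaller than r' by more than
  \<open>s1\<close>, so by compactness neither lies in the block of r'. The same separation of
  blocks holds for the unprimed values, where it yields \<open>2 * p < r\<close> and
  \<open>2 * q < r\<close>, against \<open>r \<le> p + q\<close>.\<close>

lemma same_triangle:
  assumes same: "p \<approx>\<^sub>S p'" "q \<approx>\<^sub>S q'" "r \<approx>\<^sub>S r'"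
    and nz: "p \<noteq> 0" "q \<noteq> 0" "r \<noteq> 0"
    and tri: "r \<le> p + q"
  shows "r' \<le> p' + q'"
proof (rule ccontr)
  assume less: "\<not> r' \<le> p' + q'"
  have nz': "p' \<noteq> 0" "q' \<noteq> 0" "r' \<noteq> 0"
    using nz same same_nonzero same_sym by blast+
  have ins: "p \<in> S" "q \<in> S" "r \<in> S" "p' \<in> S" "q' \<in> S" "r' \<in> S"
    using same same_in by blast+
  have smaller: "2 * x < r"
    if x: "x \<approx>\<^sub>S x'" "x \<noteq> 0" "x' + s1 < r'" for x x'
  proof -
    have x': "x \<in> S" "x' \<in> S" "x' \<noteq> 0"
      using x same_in same_nonzero same_sym by blast+
    have ns': "\<not> x' \<approx>\<^sub>S r'"
      using x(3) same_close[of x' r'] nz' by auto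
    then have ns: "\<not> x \<approx>\<^sub>S r"
      using x(1) same(3) same_sym same_trans by meson
    have "2 * x' < r'"
      using double_less[OF _ _ ns'] x' ins x(3) s1_pos by simp
    moreover have "\<bar>r - r'\<bar> \<le> s1" "\<bar>x - x'\<bar> \<le> s1"
      using same_close same(3) x(1) x' nz' by blast+
    moreover have "s1 \<le> r" "s1 \<le> x'"
      using s1_le ins nz x' by blast+
    \<comment> \<open>The order of the two blocks cannot flip: \<open>x \<le> x' + s1 < r' / 2 + s1
      \<le> (r + s1) / 2 + s1 \<le> 2 * r\<close>.\<close>
    ultimately have "\<not> 2 * r < x"
      by linarith
    then have "x < r"
      using double_less[of r x] ns same_sym x'(1) ins(3) same_refl by (metis linorder_neqE)
    then show ?thesis
      using double_less ns x' ins by blast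
  qed
  have "s1 \<le> p'" "s1 \<le> q'"
    using s1_le ins nz' by blast+
  then have "2 * p < r" "2 * q < r"
    using smaller[OF same(1) nz(1)] smaller[OF same(2) nz(2)] less by auto
  then show False
    using tri by simp
qed

end

section \<open>Spaces spanned by \<open>L\<close>\<close>

text \<open>Keeps \<open>block S 1\<close> folded, so that \<open>B1\<close> is handled through its
  lemmas instead of as an interval.\<close>

declare block.simps(2) [simp del] One_nat_def [simp del]

text \<open>\<open>\<rho>\<close> collapses the \<open>\<sim>\<close>-classes of a space spanned by \<open>L\<close> to the points of \<open>L\<close>. No triangle
  inequality is required of \<open>d\<close>: it is automatic.\<close>

definition fibred ::
    "real set \<Rightarrow> 'b metric \<Rightarrow> 'c set \<Rightarrow> ('c \<Rightarrow> 'c \<Rightarrow> real) \<Rightarrow> ('c \<Rightarrow> 'b) \<Rightarrow> bool" where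
  "fibred S L M d \<rho> \<longleftrightarrow> \<rho> \<in> M \<rightarrow> mspace L \<and>
     (\<forall>x\<in>M. \<forall>y\<in>M. d y x = d x y \<and>
        (if x = y then d x y = 0
         else if \<rho> x = \<rho> y then d x y \<in> block S 1
         else same_block S (d x y) (mdist L (\<rho> x) (\<rho> y))))"

lemma isometric_embedding_comp:
  "isometric_embedding X Y f \<Longrightarrow> isometric_embedding Y Z g \<Longrightarrow> isometric_embedding X Z (g \<circ> f)"
  by (auto simp: isometric_embedding_def Pi_iff)

lemma isometric_embedding_inj_on: "isometric_embedding X Y f \<Longrightarrow> inj_on f (mspace X)"
  unfolding isometric_embedding_def inj_on_def by (metis PiE mdist_zero)

lemma metric_on_carrier:
  assumes "\<And>x y. x \<in> M \<Longrightarrow> y \<in> M \<Longrightarrow> 0 \<le> d x y"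
    and "\<And>x y. x \<in> M \<Longrightarrow> y \<in> M \<Longrightarrow> d y x = d x y"
    and "\<And>x y. x \<in> M \<Longrightarrow> y \<in> M \<Longrightarrow> d x y = 0 \<longleftrightarrow> x = y"
    and "\<And>x y z. x \<in> M \<Longrightarrow> y \<in> M \<Longrightarrow> z \<in> M \<Longrightarrow> d x z \<le> d x y + d y z"
  obtains X where "mspace X = M" "\<And>x y. x \<in> M \<Longrightarrow> y \<in> M \<Longrightarrow> mdist X x y = d x y"
proof -
  \<comment> \<open>\<open>Metric_space\<close> demands nonnegativity and symmetry on the whole
    type, hence the value 0 off M.\<close>
  define d' where "d' = (\<lambda>x y. if x \<in> M \<and> y \<in> M then d x y else 0)"
  have "Metric_space M d'"
    using assms by unfold_locales (auto simp: d'_def)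
  then show thesis
    using that[of "metric (M, d')"]
    by (simp add: Metric_space.mspace_metric Metric_space.mdist_metric d'_def)
qed

section \<open>The relation that collapses distances in the first block\<close>

context compact_blocks
begin

text \<open>For transitivity: a third side outside \<open>{0} \<union> B1\<close> would exceed twice
  each of the other two, hence their sum.\<close>

lemma sim_equiv:
  assumes "has_distances_in X S"
  shows "equiv (mspace X) (sim_rel S X)"
proof (rule equivI)
  show "sim_rel S X \<subseteq> mspace X \<times> mspace X"
    by (auto simp: sim_rel_def)
  show "refl_on (mspace X) (sim_rel S X)"
    by (auto simp: sim_rel_def refl_on_def)
  show "sym (sim_rel S X)"
    by (auto simp: sim_rel_def sym_def mdist_commute)
  show "trans (sim_rel S X)"
  proof (rule transI)
    fix x y z
    assume "(x, y) \<in> sim_rel S X" "(y, z) \<in> sim_rel S X"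
    then have m: "x \<in> mspace X" "y \<in> mspace X" "z \<in> mspace X"
      and d: "mdist X x y \<in> {0} \<union> B1" "mdist X y z \<in> {0} \<union> B1"
      by (auto simp: sim_rel_def)
    have "mdist X x z \<in> {0} \<union> B1"
    proof (rule ccontr)
      assume n: "mdist X x z \<notin> {0} \<union> B1"
      have "mdist X x z \<in> S"
        using assms m by (auto simp: has_distances_in_def)
      then have "2 * mdist X x y < mdist X x z" "2 * mdist X y z < mdist X x z"
        using double_B1_less d n by blast+
      then show False
        using mdist_triangle[OF m] by simp
    qed
    then show "(x, z) \<in> sim_rel S X"
      using m by (simp add: sim_rel_def)
  qed
qed

lemma sim_iff:
  "(x, y) \<in> sim_rel S X \<longleftrightarrow> x \<in> mspace X \<and> y \<in> mspace X \<and> mdist X x y \<in> {0} \<union> B1"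
  by (simp add: sim_rel_def)

text \<open>Makes the block of the distance between two classes well defined. The two distances
  differ by at most \<open>mdist X x x'\<close>, whose double is below both; in different blocks one
  would be more than twice the other, so they would differ by more than that.\<close>

lemma sim_same_dist:
  assumes X: "has_distances_in X S" and sim: "(x, x') \<in> sim_rel S X"
    and y: "y \<in> mspace X" "(x, y) \<notin> sim_rel S X"
  shows "mdist X x y \<approx>\<^sub>S mdist X x' y"
proof (rule ccontr)
  let ?p = "mdist X x y" and ?q = "mdist X x' y"
  assume ns: "\<not> ?p \<approx>\<^sub>S ?q"
  have m: "x \<in> mspace X" "x' \<in> mspace X" and d: "mdist X x x' \<in> {0} \<union> B1"
    using sim by (auto simp: sim_iff)
  have "(x', y) \<notin> sim_rel S X"
    using sim_equiv[OF X] sim y(2) by (meson equivE transD)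
  then have n: "?p \<notin> {0} \<union> B1" "?q \<notin> {0} \<union> B1"
    using y m by (auto simp: sim_iff)
  have S: "?p \<in> S" "?q \<in> S"
    using X m y by (auto simp: has_distances_in_def)
  have "2 * mdist X x x' < ?p" "2 * mdist X x x' < ?q"
    using double_B1_less[OF d] S n by blast+
  moreover have "?p \<le> mdist X x x' + ?q" "?q \<le> mdist X x x' + ?p"
    using mdist_triangle[of x X x' y] mdist_triangle[of x' X x y] m y
    by (auto simp: mdist_commute)
  moreover have "2 * ?p < ?q \<or> 2 * ?q < ?p"
    using double_less[of ?p ?q] double_less[of ?q ?p] ns same_sym same_refl S
    by (metis linorder_neqE)
  moreover have "0 \<le> mdist X x x'"
    by simp
  ultimately show False
    by linarith
qed

lemma B1_dist_le:
  assumes "d \<in> S" "d \<noteq> 0" "e \<in> S" "e \<noteq> 0" "b \<in> B1"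
  shows "b \<le> d + e"
  using s1_le[OF assms(1,2)] s1_le[OF assms(3,4)] B1_bounds(4)[OF assms(5)] by simp

end

section \<open>Fibred distances and membership in the spanned class\<close>

locale spanning = compact_blocks +
  fixes L :: "'b metric"
  assumes finite_L: "finite (mspace L)" and L_ne: "mspace L \<noteq> {}"
    and L_dist: "has_distances_in L (S - B1)"
begin

lemma L_dist_far:
  assumes "l \<in> mspace L" "l' \<in> mspace L" "l \<noteq> l'"
  shows "mdist L l l' \<in> S" "mdist L l l' \<noteq> 0" "mdist L l l' \<notin> {0} \<union> B1"
  using L_dist assms by (auto simp: has_distances_in_def)

text \<open>The last part identifies the fibres of \<open>\<rho>\<close> with the classes: a
  distance between fibres shares a block with a distance of L, and L takes none in
  \<open>B1\<close>.\<close>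

lemma fibred_dist:
  assumes F: "fibred S L M d \<rho>" and "x \<in> M" "y \<in> M"
  shows "d y x = d x y" "d x y \<in> S" "d x y = 0 \<longleftrightarrow> x = y" "d x y \<in> {0} \<union> B1 \<longleftrightarrow> \<rho> x = \<rho> y"
proof -
  show "d y x = d x y"
    using assms by (simp add: fibred_def)
  have r: "\<rho> x \<in> mspace L" "\<rho> y \<in> mspace L"
    using assms by (auto simp: fibred_def)
  consider "x = y" "d x y = 0" | "x \<noteq> y" "\<rho> x = \<rho> y" "d x y \<in> B1"
    | "x \<noteq> y" "\<rho> x \<noteq> \<rho> y" "d x y \<approx>\<^sub>S mdist L (\<rho> x) (\<rho> y)"
    using assms unfolding fibred_def by meson
  then have "d x y \<in> S \<and> (d x y = 0 \<longleftrightarrow> x = y) \<and> (d x y \<in> {0} \<union> B1 \<longleftrightarrow> \<rho> x = \<rho> y)"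
  proof cases
    case 1
    then show ?thesis
      by (simp add: zero_in)
  next
    case 2
    then show ?thesis
      using B1_bounds by blast
  next
    case 3
    have "d x y \<noteq> 0"
      using L_dist_far[OF r 3(2)] same_nonzero[OF 3(3)] by blast
    moreover have "d x y \<notin> B1"
      using L_dist_far[OF r 3(2)] 3(3) B1_iff same_sym same_trans by blast
    ultimately show ?thesis
      using 3 same_in by blast
  qed
  then show "d x y \<in> S" "d x y = 0 \<longleftrightarrow> x = y" "d x y \<in> {0} \<union> B1 \<longleftrightarrow> \<rho> x = \<rho> y"
    by blast+
qed

lemma fibred_near:
  assumes "fibred S L M d \<rho>" "x \<in> M" "y \<in> M" "x \<noteq> y" "\<rho> x = \<rho> y"
  shows "d x y \<in> B1"
  using assms by (auto simp: fibred_def)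

lemma fibred_far:
  assumes "fibred S L M d \<rho>" "x \<in> M" "y \<in> M" "\<rho> x \<noteq> \<rho> y"
  shows "d x y \<approx>\<^sub>S mdist L (\<rho> x) (\<rho> y)"
proof -
  have "x \<noteq> y"
    using assms(4) by blast
  then show ?thesis
    using assms by (simp add: fibred_def)
qed

text \<open>For distinct points there are three situations. If x and z share a fibre,
  \<open>d x z\<close> is at most \<open>2 * s1\<close>. If y shares a fibre with just one of them,
  the two distances between fibres lie in one block and differ by at most \<open>s1\<close>, which
  the third side makes up for. Over three different fibres the inequality is inherited from L by
  \<open>same_triangle\<close>.\<close>

lemma fibred_triangle:
  assumes F: "fibred S L M d \<rho>" and M: "x \<in> M" "y \<in> M" "z \<in> M"
  shows "d x z \<le> d x y + d y z"
proof -
  note D = fibred_dist[OF F]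
  have nn: "0 \<le> d x y" "0 \<le> d y z"
    using D(2) M nonneg by blast+
  have r: "\<rho> x \<in> mspace L" "\<rho> y \<in> mspace L" "\<rho> z \<in> mspace L"
    using F M by (auto simp: fibred_def)
  consider "x = y \<or> y = z \<or> x = z" | "x \<noteq> y" "y \<noteq> z" "x \<noteq> z"
    by blast
  then show ?thesis
  proof cases
    case 1
    then show ?thesis
      using D(3) M nn by (smt (verit))
  next
    case 2
    have S: "d x y \<in> S" "d y z \<in> S" "d x z \<in> S" "d x y \<noteq> 0" "d y z \<noteq> 0" "d x z \<noteq> 0"
      using D(2,3) M 2 by auto
    have s: "s1 \<le> d x y" "s1 \<le> d y z"
      using s1_le S by auto
    consider "\<rho> x = \<rho> z" | "\<rho> x \<noteq> \<rho> z" "\<rho> x = \<rho> y" | "\<rho> x \<noteq> \<rho> z" "\<rho> y = \<rho> z"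
      | "\<rho> x \<noteq> \<rho> z" "\<rho> x \<noteq> \<rho> y" "\<rho> y \<noteq> \<rho> z"
      by blast
    then show ?thesis
    proof cases
      case 1
      then show ?thesis
        using B1_dist_le S fibred_near[OF F M(1,3)] 2(3) by simp
    next
      case c: 2
      have "d x z \<approx>\<^sub>S d y z"
        using fibred_far[OF F] M c same_sym same_trans by metis
      then show ?thesis
        using same_close S s by fastforce
    next
      case c: 3
      have "d x z \<approx>\<^sub>S d x y"
        using fibred_far[OF F] M c same_sym same_trans by metis
      then show ?thesis
        using same_close S s by fastforce
    next
      case c: 4
      show ?thesis
        using same_triangle[OF fibred_far[OF F M(1,2) c(2), THEN same_sym]
            fibred_far[OF F M(2,3) c(3), THEN same_sym] fibred_far[OF F M(1,3) c(1), THEN same_sym]]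
          L_dist_far r c mdist_triangle[OF r] by blast
    qed
  qed
qed

text \<open>The copy of L is itself the transversal: it meets every class by assumption, and no
  class twice because L has no distance in \<open>B1\<close>.\<close>

lemma Met_spannedI:
  assumes X: "X \<in> Met S" and h: "isometric_embedding L X h"
    and cover: "\<And>x. x \<in> mspace X \<Longrightarrow> \<exists>l\<in>mspace L. (h l, x) \<in> sim_rel S X"
  shows "X \<in> Met_spanned S L"
proof -
  have XS: "has_distances_in X S"
    using X by (simp add: Met_def)
  note E = sim_equiv[OF XS]
  have hX: "h l \<in> mspace X" if "l \<in> mspace L" for l
    using h that by (auto simp: isometric_embedding_def)
  have eq: "l = l'" if l: "l \<in> mspace L" "l' \<in> mspace L" "(h l, h l') \<in> sim_rel S X" for l l'
    using h l L_dist_far(3)[of l l'] by (auto simp: sim_iff isometric_embedding_def)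
  define c where "c l = sim_rel S X `` {h l}" for l
  have bij: "bij_betw c (mspace L) (mspace X // sim_rel S X)"
  proof (rule bij_betw_imageI)
    show "inj_on c (mspace L)"
      unfolding inj_on_def c_def using eq hX eq_equiv_class[OF _ E] by blast
    show "c ` mspace L = mspace X // sim_rel S X"
    proof
      show "c ` mspace L \<subseteq> mspace X // sim_rel S X"
        using hX by (auto simp: c_def intro: quotientI)
      show "mspace X // sim_rel S X \<subseteq> c ` mspace L"
      proof
        fix Q assume "Q \<in> mspace X // sim_rel S X"
        then obtain x where x: "x \<in> mspace X" "Q = sim_rel S X `` {x}"
          by (rule quotientE)
        then obtain l where l: "l \<in> mspace L" "(h l, x) \<in> sim_rel S X"
          using cover by blast
        then have "Q = c l"
          using equiv_class_eq[OF E l(2)] x(2) by (simp add: c_def)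
        then show "Q \<in> c ` mspace L"
          using l(1) by blast
      qed
    qed
  qed
  have c: "c ` mspace L = mspace X // sim_rel S X"
    using bij by (rule bij_betw_imp_surj_on)
  have Q: "mspace X // sim_rel S X \<approx> mspace L"
    using bij eqpoll_def eqpoll_sym by blast
  let ?T = "h ` mspace L"
  have "\<exists>!a. a \<in> ?T \<inter> c l" if l: "l \<in> mspace L" for l
  proof (rule ex1I[of _ "h l"])
    show "h l \<in> ?T \<inter> c l"
      using l hX[OF l] by (simp add: c_def sim_iff)
    show "a = h l" if "a \<in> ?T \<inter> c l" for a
      using that eq l by (auto simp: c_def)
  qed
  then have T: "\<forall>A\<in>mspace X // sim_rel S X. \<exists>!a. a \<in> ?T \<inter> A"
    unfolding c[symmetric] by blast
  have inj: "inj_on h (mspace L)"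
    using h by (rule isometric_embedding_inj_on)
  have TX: "?T \<subseteq> mspace X"
    using hX by blast
  have "isometric (submetric X ?T) L"
    unfolding isometric_def
  proof (intro exI conjI)
    show "isometric_embedding (submetric X ?T) L (inv_into (mspace L) h)"
      using h inj by (auto simp: isometric_embedding_def)
    have "?T \<inter> mspace X = ?T"
      using TX by blast
    then show "inv_into (mspace L) h ` mspace (submetric X ?T) = mspace L"
      using inj by simp
  qed
  then show ?thesis
    using X Q T TX by (auto simp: Met_spanned_def spans_def)
qed

lemma Met_spanned_embedding:
  assumes "X \<in> Met_spanned S L"
  obtains h where "isometric_embedding L X h"
proof -
  obtain T f where T: "T \<subseteq> mspace X" and f: "isometric_embedding (submetric X T) L f"
      "f ` mspace (submetric X T) = mspace L"
    using assms by (auto simp: Met_spanned_def spans_def isometric_def)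
  have TX: "T \<inter> mspace X = T"
    using T by blast
  have inv: "inv_into T f l \<in> T" "f (inv_into T f l) = l" if "l \<in> mspace L" for l
    using f(2) that TX by (auto intro: inv_into_into f_inv_into_f)
  have d: "mdist L (f x) (f y) = mdist X x y" if "x \<in> T" "y \<in> T" for x y
    using f(1) that T by (auto simp: isometric_embedding_def)
  have "isometric_embedding L X (inv_into T f)"
    unfolding isometric_embedding_def
  proof (intro conjI ballI Pi_I)
    fix l l' assume l: "l \<in> mspace L" "l' \<in> mspace L"
    show "mdist X (inv_into T f l) (inv_into T f l') = mdist L l l'"
      using d[OF inv(1)[OF l(1)] inv(1)[OF l(2)]] inv(2) l by simp
  qed (use inv T in blast)
  then show thesis
    using that by blast
qed

text \<open>Finiteness of \<open>L\<close> enters here: the classes of the points \<open>h l\<close> are pairwise distinct,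
  and there are only as many classes as points of \<open>L\<close>.\<close>

lemma Met_spanned_cover:
  assumes X: "X \<in> Met_spanned S L" and h: "isometric_embedding L X h" and x: "x \<in> mspace X"
  shows "\<exists>l\<in>mspace L. (x, h l) \<in> sim_rel S X"
proof -
  have XS: "has_distances_in X S" and Q: "mspace X // sim_rel S X \<approx> mspace L"
    using X by (auto simp: Met_spanned_def spans_def Met_def)
  note E = sim_equiv[OF XS]
  have hX: "h l \<in> mspace X" if "l \<in> mspace L" for l
    using h that by (auto simp: isometric_embedding_def)
  define c where "c l = sim_rel S X `` {h l}" for l
  have "inj_on c (mspace L)"
  proof (rule inj_onI)
    fix l l' assume l: "l \<in> mspace L" "l' \<in> mspace L" "c l = c l'"
    then have "(h l, h l') \<in> sim_rel S X"
      using eq_equiv_class[OF _ E] hX by (simp add: c_def)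
    then show "l = l'"
      using h l L_dist_far(3)[of l l'] by (auto simp: sim_iff isometric_embedding_def)
  qed
  moreover have "finite (mspace X // sim_rel S X)" "card (mspace X // sim_rel S X) = card (mspace L)"
    using Q finite_L eqpoll_finite_iff eqpoll_iff_card by blast+
  moreover have "c ` mspace L \<subseteq> mspace X // sim_rel S X"
    using hX by (auto simp: c_def intro: quotientI)
  ultimately have "c ` mspace L = mspace X // sim_rel S X"
    by (simp add: card_image card_subset_eq)
  then obtain l where "l \<in> mspace L" "sim_rel S X `` {x} = sim_rel S X `` {h l}"
    using quotientI[OF x, of "sim_rel S X"] by (auto simp: c_def)
  then show ?thesis
    using eq_equiv_class[OF _ E] hX by blast
qed

text \<open>\<open>\<rho>\<close> labels a point by the l whose image \<open>h l\<close> lies in its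
  class. Moving first x and then y to these representatives by \<open>sim_same_dist\<close> compares
  their distance with one of L. The second conclusion ties the labelling to h, so that labellings of
  different spaces can be compared.\<close>

lemma Met_spanned_fibred:
  assumes X: "X \<in> Met_spanned S L" and h: "isometric_embedding L X h"
  obtains \<rho> where "fibred S L (mspace X) (mdist X) \<rho>"
    "\<And>x l. x \<in> mspace X \<Longrightarrow> l \<in> mspace L \<Longrightarrow> \<rho> x = l \<longleftrightarrow> (x, h l) \<in> sim_rel S X"
proof -
  have XS: "has_distances_in X S"
    using X by (auto simp: Met_spanned_def Met_def)
  have E: "sym (sim_rel S X)" "trans (sim_rel S X)"
    using sim_equiv[OF XS] by (auto elim: equivE)
  have hX: "h l \<in> mspace X" if "l \<in> mspace L" for l
    using h that by (auto simp: isometric_embedding_def)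
  obtain \<rho> where \<rho>: "\<rho> x \<in> mspace L \<and> (x, h (\<rho> x)) \<in> sim_rel S X" if "x \<in> mspace X" for x
    using Met_spanned_cover[OF X h] by metis
  have eq: "l = l'" if l: "l \<in> mspace L" "l' \<in> mspace L" "(h l, h l') \<in> sim_rel S X" for l l'
    using h l L_dist_far(3)[of l l'] by (auto simp: sim_iff isometric_embedding_def)
  have iff: "\<rho> x = l \<longleftrightarrow> (x, h l) \<in> sim_rel S X" if "x \<in> mspace X" "l \<in> mspace L" for x l
    using \<rho>[OF that(1)] that(2) eq E by (meson symD transD)
  have "if x = y then mdist X x y = 0
         else if \<rho> x = \<rho> y then mdist X x y \<in> B1
         else mdist X x y \<approx>\<^sub>S mdist L (\<rho> x) (\<rho> y)"
    if m: "x \<in> mspace X" "y \<in> mspace X" for x y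
  proof -
    have near: "mdist X x y \<in> B1" if "x \<noteq> y" "\<rho> x = \<rho> y"
    proof -
      have "(x, y) \<in> sim_rel S X"
        using \<rho>[OF m(1)] \<rho>[OF m(2)] that(2) E by (metis symD transD)
      then show ?thesis
        using that(1) m by (auto simp: sim_iff)
    qed
    have far: "mdist X x y \<approx>\<^sub>S mdist L (\<rho> x) (\<rho> y)" if ne: "\<rho> x \<noteq> \<rho> y"
    proof -
      have r: "\<rho> x \<in> mspace L" "\<rho> y \<in> mspace L"
        and s: "(x, h (\<rho> x)) \<in> sim_rel S X" "(y, h (\<rho> y)) \<in> sim_rel S X"
        using \<rho> m by auto
      have "(x, y) \<notin> sim_rel S X"
        using iff[OF m(1) r(2)] ne s E by (meson transD)
      then have "mdist X x y \<approx>\<^sub>S mdist X (h (\<rho> x)) y"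
        using sim_same_dist[OF XS s(1) m(2)] by blast
      also have "(y, h (\<rho> x)) \<notin> sim_rel S X"
        using iff[OF m(2) r(1)] ne by simp
      then have "mdist X (h (\<rho> x)) y \<approx>\<^sub>S mdist X (h (\<rho> x)) (h (\<rho> y))"
        using sim_same_dist[OF XS s(2) hX[OF r(1)]] by (simp add: mdist_commute)
      also have "mdist X (h (\<rho> x)) (h (\<rho> y)) = mdist L (\<rho> x) (\<rho> y)"
        using h r by (simp add: isometric_embedding_def)
      finally show ?thesis .
    qed
    show ?thesis
      using near far m by simp
  qed
  then have "fibred S L (mspace X) (mdist X) \<rho>"
    unfolding fibred_def using \<rho> by (simp add: Pi_iff mdist_commute)
  then show thesis
    using that iff by blast
qed

text \<open>Converse of the previous lemma, with h an isometric section of \<open>\<rho>\<close>.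
  All new spaces below are built through it, so their triangle inequality is never checked by
  hand.\<close>

lemma fibred_Met_spanned:
  assumes F: "fibred S L M d \<rho>" and "countable M"
    and h: "h \<in> mspace L \<rightarrow> M" "\<And>l. l \<in> mspace L \<Longrightarrow> \<rho> (h l) = l"
      "\<And>l l'. l \<in> mspace L \<Longrightarrow> l' \<in> mspace L \<Longrightarrow> d (h l) (h l') = mdist L l l'"
  obtains X where "mspace X = M" "\<And>x y. x \<in> M \<Longrightarrow> y \<in> M \<Longrightarrow> mdist X x y = d x y"
    "X \<in> Met_spanned S L"
proof -
  note D = fibred_dist[OF F]
  obtain X where X: "mspace X = M" "\<And>x y. x \<in> M \<Longrightarrow> y \<in> M \<Longrightarrow> mdist X x y = d x y"
  proof (rule metric_on_carrier[of M d])
    show "0 \<le> d x y" if "x \<in> M" "y \<in> M" for x y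
      using D(2) nonneg that by blast
  qed (use D fibred_triangle[OF F] in auto)
  have "X \<in> Met_spanned S L"
  proof (rule Met_spannedI)
    show "X \<in> Met S"
      using X D \<open>countable M\<close> by (auto simp: Met_def has_distances_in_def)
    show "isometric_embedding L X h"
      using X h by (auto simp: isometric_embedding_def Pi_iff)
    show "\<exists>l\<in>mspace L. (h l, x) \<in> sim_rel S X" if "x \<in> mspace X" for x
    proof
      show r: "\<rho> x \<in> mspace L"
        using F that X by (auto simp: fibred_def)
      then have "h (\<rho> x) \<in> M"
        using h by blast
      then show "(h (\<rho> x), x) \<in> sim_rel S X"
        using that X h(2)[OF r] D(4)[of "h (\<rho> x)" x] by (simp add: sim_iff)
    qed
  qed
  then show thesis
    using that X by blast
qed

text \<open>Changes the type of the points: amalgams and the universal space are first built on sums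
  and pairs.\<close>

lemma Met_spanned_copy:
  fixes X :: "'c metric" and j :: "'c \<Rightarrow> 'd"
  assumes X: "X \<in> Met_spanned S L" and j: "inj_on j (mspace X)"
  obtains Y where "Y \<in> Met_spanned S L" "mspace Y = j ` mspace X" "isometric_embedding X Y j"
proof -
  obtain h where h: "isometric_embedding L X h"
    using Met_spanned_embedding[OF X] by blast
  obtain \<rho> where F: "fibred S L (mspace X) (mdist X) \<rho>"
    and \<rho>: "\<And>x l. x \<in> mspace X \<Longrightarrow> l \<in> mspace L \<Longrightarrow> \<rho> x = l \<longleftrightarrow> (x, h l) \<in> sim_rel S X"
    using Met_spanned_fibred[OF X h] by blast
  let ?i = "inv_into (mspace X) j"
  have hX: "h l \<in> mspace X" if "l \<in> mspace L" for l
    using h that by (auto simp: isometric_embedding_def)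
  have ij: "?i (j x) = x" if "x \<in> mspace X" for x
    using j that by simp
  have "fibred S L (j ` mspace X) (\<lambda>x y. mdist X (?i x) (?i y)) (\<rho> \<circ> ?i)"
    using F j unfolding fibred_def by (auto simp: Pi_iff inj_on_eq_iff)
  then obtain Y where Y: "mspace Y = j ` mspace X" "Y \<in> Met_spanned S L"
    "\<And>x y. x \<in> j ` mspace X \<Longrightarrow> y \<in> j ` mspace X \<Longrightarrow> mdist Y x y = mdist X (?i x) (?i y)"
  proof (rule fibred_Met_spanned[where h = "j \<circ> h"])
    show "countable (j ` mspace X)"
      using X by (simp add: Met_spanned_def Met_def)
    show "j \<circ> h \<in> mspace L \<rightarrow> j ` mspace X"
      using hX by auto
    show "(\<rho> \<circ> ?i) ((j \<circ> h) l) = l" if "l \<in> mspace L" for l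
      using \<rho>[OF hX[OF that] that] hX[OF that] ij by (simp add: sim_iff)
    show "mdist X (?i ((j \<circ> h) l)) (?i ((j \<circ> h) l')) = mdist L l l'"
      if "l \<in> mspace L" "l' \<in> mspace L" for l l'
      using h that hX ij by (simp add: isometric_embedding_def)
  qed (use that in blast)
  moreover have "isometric_embedding X Y j"
    using Y ij by (auto simp: isometric_embedding_def)
  ultimately show thesis
    using that by blast
qed

end

section \<open>Amalgamation and a universal space\<close>

context spanning
begin

lemma amalgamation:
  fixes A :: "'p metric" and B :: "'q metric" and C :: "'r metric"
  assumes A: "A \<in> Met_spanned S L" and B: "B \<in> Met_spanned S L" and C: "C \<in> Met_spanned S L"
    and f: "isometric_embedding A B f" and g: "isometric_embedding A C g"
  obtains D :: "('q + 'r) metric" and f' g' where "D \<in> Met_spanned S L"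
    "mspace D \<subseteq> mspace B <+> mspace C"
    "isometric_embedding B D f'" "isometric_embedding C D g'"
    "\<And>a. a \<in> mspace A \<Longrightarrow> f' (f a) = g' (g a)"
proof -
  obtain h where h: "isometric_embedding L A h"
    using Met_spanned_embedding[OF A] by blast
  \<comment> \<open>All three labellings come from one copy of L inside A, so f and g preserve
    labels.\<close>
  note hB = isometric_embedding_comp[OF h f] and hC = isometric_embedding_comp[OF h g]
  obtain \<rho>A where \<rho>A: "fibred S L (mspace A) (mdist A) \<rho>A"
      "\<And>x l. x \<in> mspace A \<Longrightarrow> l \<in> mspace L \<Longrightarrow> \<rho>A x = l \<longleftrightarrow> (x, h l) \<in> sim_rel S A"
    using Met_spanned_fibred[OF A h] by blast
  obtain \<rho>B where \<rho>B: "fibred S L (mspace B) (mdist B) \<rho>B"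
      "\<And>x l. x \<in> mspace B \<Longrightarrow> l \<in> mspace L \<Longrightarrow> \<rho>B x = l \<longleftrightarrow> (x, (f \<circ> h) l) \<in> sim_rel S B"
    using Met_spanned_fibred[OF B hB] by blast
  obtain \<rho>C where \<rho>C: "fibred S L (mspace C) (mdist C) \<rho>C"
      "\<And>x l. x \<in> mspace C \<Longrightarrow> l \<in> mspace L \<Longrightarrow> \<rho>C x = l \<longleftrightarrow> (x, (g \<circ> h) l) \<in> sim_rel S C"
    using Met_spanned_fibred[OF C hC] by blast
  have inL: "\<rho>A a \<in> mspace L" "\<rho>B b \<in> mspace L" "\<rho>C c \<in> mspace L"
    if "a \<in> mspace A" "b \<in> mspace B" "c \<in> mspace C" for a b c
    using \<rho>A(1) \<rho>B(1) \<rho>C(1) that by (auto simp: fibred_def)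
  have hA: "h l \<in> mspace A" if "l \<in> mspace L" for l
    using h that by (auto simp: isometric_embedding_def)
  have fB: "f a \<in> mspace B" and gC: "g a \<in> mspace C" if "a \<in> mspace A" for a
    using f g that by (auto simp: isometric_embedding_def)
  have fd: "mdist B (f a) (f a') = mdist A a a'" and gd: "mdist C (g a) (g a') = mdist A a a'"
    if "a \<in> mspace A" "a' \<in> mspace A" for a a'
    using f g that by (auto simp: isometric_embedding_def)
  have fi: "inv_into (mspace A) f (f a) = a" and gi: "inv_into (mspace A) g (g a) = a"
    if "a \<in> mspace A" for a
    using that inv_into_f_f[OF isometric_embedding_inj_on[OF f]]
      inv_into_f_f[OF isometric_embedding_inj_on[OF g]] by blast+
  have \<rho>fg: "\<rho>B (f a) = \<rho>A a" "\<rho>C (g a) = \<rho>A a" if a: "a \<in> mspace A" for a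
  proof -
    have l: "\<rho>A a \<in> mspace L"
      using \<rho>A(1) a by (auto simp: fibred_def)
    have "mdist A a (h (\<rho>A a)) \<in> {0} \<union> B1"
      using \<rho>A(2)[OF a l] unfolding sim_iff by blast
    then have "(f a, (f \<circ> h) (\<rho>A a)) \<in> sim_rel S B" "(g a, (g \<circ> h) (\<rho>A a)) \<in> sim_rel S C"
      unfolding sim_iff o_apply fd[OF a hA[OF l]] gd[OF a hA[OF l]]
      using fB gC a hA[OF l] by blast+
    then show "\<rho>B (f a) = \<rho>A a" "\<rho>C (g a) = \<rho>A a"
      using \<rho>B(2)[OF fB[OF a] l] \<rho>C(2)[OF gC[OF a] l] by blast+
  qed
  have \<rho>h: "\<rho>B (f (h l)) = l" if "l \<in> mspace L" for l
    using \<rho>fg(1)[OF hA[OF that]] \<rho>A(2)[OF hA[OF that] that] hA[OF that] by (simp add: sim_iff)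

  \<comment> \<open>A point of B that comes from A already has a distance to c in C; all other pairs
    get the default, which depends on their labels alone.\<close>
  define cross where "cross b c =
    (if b \<in> f ` mspace A then mdist C (g (inv_into (mspace A) f b)) c
     else if \<rho>B b = \<rho>C c then s1 else mdist L (\<rho>B b) (\<rho>C c))" for b c
  define d where "d x y = (case x of
      Inl b \<Rightarrow> (case y of Inl b' \<Rightarrow> mdist B b b' | Inr c \<Rightarrow> cross b c)
    | Inr c \<Rightarrow> (case y of Inl b \<Rightarrow> cross b c | Inr c' \<Rightarrow> mdist C c c'))" for x y
  \<comment> \<open>Points coming from A are represented by their copies in B.\<close>
  define M where "M = mspace B <+> (mspace C - g ` mspace A)"
  have cross: "if \<rho>B b = \<rho>C c then cross b c \<in> B1
      else cross b c \<approx>\<^sub>S mdist L (\<rho>B b) (\<rho>C c)"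
    if b: "b \<in> mspace B" and c: "c \<in> mspace C" "c \<notin> g ` mspace A" for b c
  proof (cases "b \<in> f ` mspace A")
    case True
    then obtain a where a: "a \<in> mspace A" "b = f a"
      by blast
    have "cross b c = mdist C (g a) c"
      using a fi[OF a(1)] by (simp add: cross_def)
    moreover have "\<rho>B b = \<rho>C (g a)" "g a \<noteq> c"
      using a c(2) \<rho>fg[OF a(1)] by auto
    ultimately show ?thesis
      using fibred_near[OF \<rho>C(1) gC[OF a(1)] c(1)] fibred_far[OF \<rho>C(1) gC[OF a(1)] c(1)] by simp
  next
    case False
    \<comment> \<open>\<open>inL\<close> speaks of points of all three spaces at once, so a point of
      A has to be supplied.\<close>
    obtain a where "a \<in> mspace A"
      using L_ne hA by blast
    then show ?thesis
      using False s1_in_B1 same_refl L_dist_far(1) inL[OF _ b c(1)] by (simp add: cross_def)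
  qed
  have F: "fibred S L M d (case_sum \<rho>B \<rho>C)"
    unfolding fibred_def
  proof (intro conjI ballI)
    show "case_sum \<rho>B \<rho>C \<in> M \<rightarrow> mspace L"
      using \<rho>B(1) \<rho>C(1) by (auto simp: M_def fibred_def)
    fix x y assume x: "x \<in> M" and y: "y \<in> M"
    show "d y x = d x y"
      by (auto simp: d_def mdist_commute split: sum.split)
    show "if x = y then d x y = 0
      else if case_sum \<rho>B \<rho>C x = case_sum \<rho>B \<rho>C y then d x y \<in> B1
      else d x y \<approx>\<^sub>S mdist L (case_sum \<rho>B \<rho>C x) (case_sum \<rho>B \<rho>C y)"
    proof (cases x)
      case x': (Inl b)
      then have b: "b \<in> mspace B"
        using x by (auto simp: M_def)
      show ?thesis
      proof (cases y)
        case (Inl b')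
        then have "b' \<in> mspace B"
          using y by (auto simp: M_def)
        then show ?thesis
          using x' Inl b fibred_near[OF \<rho>B(1) b] fibred_far[OF \<rho>B(1) b] by (simp add: d_def)
      next
        case (Inr c)
        then have "c \<in> mspace C" "c \<notin> g ` mspace A"
          using y by (auto simp: M_def)
        then show ?thesis
          using x' Inr cross[OF b] by (simp add: d_def)
      qed
    next
      case x': (Inr c)
      then have c: "c \<in> mspace C" "c \<notin> g ` mspace A"
        using x by (auto simp: M_def)
      show ?thesis
      proof (cases y)
        case (Inl b)
        then have "b \<in> mspace B"
          using y by (auto simp: M_def)
        then have "if \<rho>C c = \<rho>B b then cross b c \<in> B1
            else cross b c \<approx>\<^sub>S mdist L (\<rho>C c) (\<rho>B b)"
          using cross[OF _ c] by (metis mdist_commute)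
        then show ?thesis
          using x' Inl by (simp add: d_def)
      next
        case (Inr c')
        then have "c' \<in> mspace C"
          using y by (auto simp: M_def)
        then show ?thesis
          using x' Inr c fibred_near[OF \<rho>C(1) c(1)] fibred_far[OF \<rho>C(1) c(1)] by (simp add: d_def)
      qed
    qed
  qed
  obtain D where D: "mspace D = M" "\<And>x y. x \<in> M \<Longrightarrow> y \<in> M \<Longrightarrow> mdist D x y = d x y"
    "D \<in> Met_spanned S L"
  proof (rule fibred_Met_spanned[OF F, where h = "\<lambda>l. Inl (f (h l))"])
    show "countable M"
      using B C by (auto simp: M_def Met_spanned_def Met_def)
    show "(\<lambda>l. Inl (f (h l))) \<in> mspace L \<rightarrow> M"
      using hA fB by (auto simp: M_def)
    show "case_sum \<rho>B \<rho>C (Inl (f (h l))) = l" if "l \<in> mspace L" for l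
      using \<rho>h that by simp
    show "d (Inl (f (h l))) (Inl (f (h l'))) = mdist L l l'"
      if "l \<in> mspace L" "l' \<in> mspace L" for l l'
      using hB that by (simp add: d_def isometric_embedding_def)
  qed (use that in blast)
  \<comment> \<open>Points of C that come from A are sent to their representatives in B.\<close>
  define g' where "g' c = (if c \<in> g ` mspace A then Inl (f (inv_into (mspace A) g c)) else Inr c)" for c
  have g'M: "g' c \<in> M" if "c \<in> mspace C" for c
    using that fB gi by (auto simp: g'_def M_def)
  have cross': "cross (f a) c = mdist C (g a) c" if "a \<in> mspace A" for a c
    using that fi by (simp add: cross_def)
  have g'd: "d (g' c) (g' c') = mdist C c c'" if "c \<in> mspace C" "c' \<in> mspace C" for c c'
    using that by (auto simp: g'_def d_def gi fd gd cross' mdist_commute)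
  show thesis
  proof (rule that[of D Inl g'])
    have "Inl b \<in> M" if "b \<in> mspace B" for b
      using that by (simp add: M_def InlI)
    then show "isometric_embedding B D Inl"
      using D(1,2) by (simp add: isometric_embedding_def d_def)
    show "isometric_embedding C D g'"
      using D g'M g'd by (auto simp: isometric_embedding_def)
    show "mspace D \<subseteq> mspace B <+> mspace C"
      using D(1) by (auto simp: M_def)
    show "Inl (f a) = g' (g a)" if "a \<in> mspace A" for a
      using that gi by (simp add: g'_def)
  qed (rule D(3))
qed

section \<open>A countable universal space\<close>

lemma L_spanned: "L \<in> Met_spanned S L"
proof (rule Met_spannedI[where h = id])
  show "L \<in> Met S"
    using L_dist finite_L by (auto simp: Met_def has_distances_in_def countable_finite)
qed (auto simp: isometric_embedding_def sim_iff)

text \<open>Every finite space has a copy on natural numbers, and since \<open>S\<close> is finite there are only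
  countably many distance tables of such copies; a disjoint union of one space for each table is
  universal.\<close>

lemma universal:
  obtains F :: "(nat \<times> nat) metric" where "F \<in> Met_spanned S L" "infinite (mspace F)"
    "\<And>X :: 'c metric. X \<in> Met_spanned S L \<Longrightarrow> finite (mspace X) \<Longrightarrow> embeddable X F"
proof -
  define K :: "nat metric set" where "K = {X \<in> Met_spanned S L. finite (mspace X)}"
  \<comment> \<open>Carrier and graph of the distance on it: for a finite space a pair of finite
    sets, blind to the values of \<open>mdist\<close> off the carrier.\<close>
  define table where "table X =
    (mspace X, (\<lambda>(x, y). (x, y, mdist X x y)) ` (mspace X \<times> mspace X))" for X :: "nat metric"
  \<comment> \<open>Polymorphic in the point type, as it is applied both to L and to spaces over
    \<open>'c\<close>.\<close>
  have copy: "\<exists>Y\<in>K. \<exists>j. isometric_embedding X Y j"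
    if X: "X \<in> Met_spanned S L" "finite (mspace X)" for X :: "'x metric"
  proof -
    have "inj_on (to_nat_on (mspace X)) (mspace X)"
      using X(2) by (intro inj_on_to_nat_on countable_finite)
    then obtain Y where "Y \<in> Met_spanned S L" "mspace Y = to_nat_on (mspace X) ` mspace X"
      "isometric_embedding X Y (to_nat_on (mspace X))"
      by (rule Met_spanned_copy[OF X(1)])
    then show ?thesis
      using X(2) by (auto simp: K_def)
  qed
  have "table ` K \<subseteq> Fpow UNIV \<times> Fpow (UNIV \<times> UNIV \<times> S)"
    by (auto simp: table_def K_def Fpow_def Met_spanned_def Met_def has_distances_in_def)
  moreover have "countable (Fpow (UNIV :: nat set) \<times> Fpow ((UNIV :: nat set) \<times> (UNIV :: nat set) \<times> S))"
    using finite_S by (intro countable_SIGMA countable_Fpow) (auto simp: countable_finite)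
  ultimately have "countable (table ` K)"
    using countable_subset by blast
  \<comment> \<open>\<open>from_nat_into\<close> enumerates only nonempty countable sets; a copy of
    L supplies a member.\<close>
  moreover have "table ` K \<noteq> {}"
    using copy[OF L_spanned finite_L] by blast
  ultimately have range: "range (from_nat_into (table ` K)) = table ` K"
    by (simp add: range_from_nat_into)
  then have "\<forall>i. \<exists>X\<in>K. table X = from_nat_into (table ` K) i"
    by (metis (no_types, lifting) imageE rangeI)
  then obtain X where X: "X i \<in> K" "table (X i) = from_nat_into (table ` K) i" for i
    by metis
  have "\<exists>h \<rho>. isometric_embedding L (X i) h \<and> fibred S L (mspace (X i)) (mdist (X i)) \<rho> \<and>
      (\<forall>l\<in>mspace L. \<rho> (h l) = l)" for i
  proof -
    have i: "X i \<in> Met_spanned S L"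
      using X(1) by (auto simp: K_def)
    obtain h where h: "isometric_embedding L (X i) h"
      using Met_spanned_embedding[OF i] by blast
    obtain \<rho> where \<rho>: "fibred S L (mspace (X i)) (mdist (X i)) \<rho>"
      "\<And>x l. x \<in> mspace (X i) \<Longrightarrow> l \<in> mspace L \<Longrightarrow> \<rho> x = l \<longleftrightarrow> (x, h l) \<in> sim_rel S (X i)"
      using Met_spanned_fibred[OF i h] by blast
    have "\<rho> (h l) = l" if "l \<in> mspace L" for l
    proof -
      have "h l \<in> mspace (X i)"
        using h that by (auto simp: isometric_embedding_def)
      then show ?thesis
        using \<rho>(2)[OF _ that] by (simp add: sim_iff)
    qed
    then show ?thesis
      using h \<rho>(1) by blast
  qed
  then obtain h \<rho> where h: "isometric_embedding L (X i) (h i)"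
    and \<rho>: "fibred S L (mspace (X i)) (mdist (X i)) (\<rho> i)"
    and \<rho>h: "l \<in> mspace L \<Longrightarrow> \<rho> i (h i l) = l" for i l
    by metis
  have hX: "h i l \<in> mspace (X i)" if "l \<in> mspace L" for i l
    using h[of i] that by (auto simp: isometric_embedding_def)
  define M where "M = Sigma UNIV (\<lambda>i. mspace (X i))"
  define r where "r = (\<lambda>(i, x). \<rho> i x)"
  \<comment> \<open>Points of different summands get the default distance determined by their
    labels.\<close>
  define d where "d = (\<lambda>p q. if fst p = fst q then mdist (X (fst p)) (snd p) (snd q)
    else if r p = r q then s1 else mdist L (r p) (r q))"
  have rL: "r p \<in> mspace L" if "p \<in> M" for p
    using \<rho> that by (auto simp: fibred_def M_def r_def)
  have F: "fibred S L M d r"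
    unfolding fibred_def
  proof (intro conjI ballI)
    show "r \<in> M \<rightarrow> mspace L"
      using rL by blast
    fix p q assume p: "p \<in> M" and q: "q \<in> M"
    show "d q p = d p q"
      by (simp add: d_def mdist_commute)
    show "if p = q then d p q = 0 else if r p = r q then d p q \<in> B1
      else d p q \<approx>\<^sub>S mdist L (r p) (r q)"
    proof (cases "fst p = fst q")
      case True
      then obtain i x y where "p = (i, x)" "q = (i, y)"
        by (metis prod.collapse)
      then show ?thesis
        using p q \<rho>[of i] by (auto simp: d_def r_def M_def fibred_def)
    next
      case False
      then show ?thesis
        using s1_in_B1 same_refl[OF L_dist_far(1)[OF rL[OF p] rL[OF q]]] by (auto simp: d_def)
    qed
  qed
  \<comment> \<open>The copy of L in summand 0 serves as the isometric section for the whole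
    union.\<close>
  obtain F where F: "mspace F = M" "\<And>x y. x \<in> M \<Longrightarrow> y \<in> M \<Longrightarrow> mdist F x y = d x y"
    "F \<in> Met_spanned S L"
  proof (rule fibred_Met_spanned[OF F, where h = "\<lambda>l. (0, h 0 l)"])
    show "d (0, h 0 l) (0, h 0 l') = mdist L l l'" if "l \<in> mspace L" "l' \<in> mspace L" for l l'
      using h[of 0] that by (simp add: d_def isometric_embedding_def)
  qed (use hX \<rho>h that in \<open>auto simp: M_def r_def\<close>)
  have "infinite M"
  proof -
    obtain l where "l \<in> mspace L"
      using L_ne by blast
    then have "range (\<lambda>i. (i, h i l)) \<subseteq> M"
      using hX by (auto simp: M_def)
    moreover have "infinite (range (\<lambda>i. (i, h i l)))"
      by (rule range_inj_infinite) (simp add: inj_on_def)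
    ultimately show ?thesis
      using finite_subset by blast
  qed
  moreover have "embeddable Y F" if Y: "Y \<in> Met_spanned S L" "finite (mspace Y)" for Y :: "'c metric"
  proof -
    obtain Z j where Z: "Z \<in> K" "isometric_embedding Y Z j"
      using copy[OF Y] by blast
    \<comment> \<open>A summand with the table of Z has the same points and distances, so
      \<open>Pair i\<close> embeds Z.\<close>
    then obtain i where "table Z = from_nat_into (table ` K) i"
      using range by (metis (no_types, lifting) imageE imageI)
    then have t: "table (X i) = table Z"
      using X(2) by simp
    then have m: "mspace (X i) = mspace Z"
      by (simp add: table_def)
    have "mdist (X i) x y = mdist Z x y" if "x \<in> mspace Z" "y \<in> mspace Z" for x y
    proof -
      have "(x, y, mdist Z x y) \<in> snd (table Z)"
        unfolding table_def snd_conv using that by (intro image_eqI[of _ _ "(x, y)"]) auto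
      then have "(x, y, mdist Z x y) \<in> snd (table (X i))"
        unfolding t .
      then show ?thesis
        unfolding table_def by auto
    qed
    then have "isometric_embedding Z F (Pair i)"
      using F m by (auto simp: isometric_embedding_def M_def d_def)
    then show ?thesis
      using isometric_embedding_comp[OF Z(2)] by (auto simp: embeddable_def)
  qed
  ultimately show thesis
    using that F by blast
qed

end

section \<open>Transfer to the given point type\<close>

lemma countable_inj_on_infinite_type:
  assumes "infinite (UNIV :: 'a set)" "countable M"
  obtains j :: "'c \<Rightarrow> 'a" where "inj_on j M"
proof -
  obtain e :: "nat \<Rightarrow> 'a" where "inj e"
    using infinite_countable_subset[OF assms(1)] by blast
  moreover have "inj_on (to_nat_on M) M"
    using assms(2) by (rule inj_on_to_nat_on)
  ultimately have "inj_on (e \<circ> to_nat_on M) M"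
    by (auto intro: comp_inj_on inj_on_subset)
  then show thesis
    using that by blast
qed

text \<open>The universal space and the amalgams are countable, so they have copies on the infinite
  type \<open>'a\<close>.\<close>

theorem theorem5p8:
  fixes S :: "real set" and L :: "'b metric"
  assumes "infinite (UNIV :: 'a set)"
    and "compact_distance_set S"
    and "num_blocks S \<ge> 2"
    and "finite (mspace L)" and "mspace L \<noteq> {}"
    and "has_distances_in L (S - block S 1)"
  shows "fraisse_age (Met_spanned_fin S L :: 'a metric set) (Met_spanned S L)"
proof -
  interpret spanning S L
    using assms by unfold_locales auto
  have countable: "countable (mspace X)" if "X \<in> Met_spanned S L" for X :: "'x metric"
    using that by (simp add: Met_spanned_def Met_def)
  have "is_age (Met_spanned_fin S L :: 'a metric set) (Met_spanned S L)"
  proof -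
    obtain F :: "(nat \<times> nat) metric" where F: "F \<in> Met_spanned S L" "infinite (mspace F)"
      "\<And>X :: 'a metric. X \<in> Met_spanned S L \<Longrightarrow> finite (mspace X) \<Longrightarrow> embeddable X F"
      using universal by blast
    obtain j :: "nat \<times> nat \<Rightarrow> 'a" where j: "inj_on j (mspace F)"
      using countable_inj_on_infinite_type[OF assms(1) countable[OF F(1)]] by blast
    obtain G where G: "G \<in> Met_spanned S L" "mspace G = j ` mspace F" "isometric_embedding F G j"
      using Met_spanned_copy[OF F(1) j] by blast
    \<comment> \<open>Every finite member of the ambient class embeds in G, so those that embed are
      exactly \<open>Met_spanned_fin S L\<close>.\<close>
    have "embeddable X G" if "X \<in> Met_spanned S L" "finite (mspace X)" for X :: "'a metric"
      using F(3)[OF that] isometric_embedding_comp[OF _ G(3)] by (auto simp: embeddable_def)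
    moreover have "infinite (mspace G)"
      using G(2) F(2) j finite_image_iff by metis
    ultimately show ?thesis
      unfolding is_age_def Met_spanned_fin_def using G(1) countable[OF G(1)] by blast
  qed
  moreover have "amalgamation_property (Met_spanned_fin S L :: 'a metric set)"
    unfolding amalgamation_property_def
  proof (intro ballI allI impI)
    fix A B C :: "'a metric" and f g :: "'a \<Rightarrow> 'a"
    assume K: "A \<in> Met_spanned_fin S L" "B \<in> Met_spanned_fin S L" "C \<in> Met_spanned_fin S L"
      and fg: "isometric_embedding A B f" "isometric_embedding A C g"
    then obtain D :: "('a + 'a) metric" and f' g' where D: "D \<in> Met_spanned S L"
      "mspace D \<subseteq> mspace B <+> mspace C"
      "isometric_embedding B D f'" "isometric_embedding C D g'"
      "\<And>a. a \<in> mspace A \<Longrightarrow> f' (f a) = g' (g a)"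
      using amalgamation[OF _ _ _ fg] unfolding Met_spanned_fin_def by blast
    obtain j :: "'a + 'a \<Rightarrow> 'a" where j: "inj_on j (mspace D)"
      using countable_inj_on_infinite_type[OF assms(1) countable[OF D(1)]] by blast
    obtain E where E: "E \<in> Met_spanned S L" "mspace E = j ` mspace D" "isometric_embedding D E j"
      using Met_spanned_copy[OF D(1) j] by blast
    \<comment> \<open>The amalgam has no points beyond those of B and C, which keeps it in the
      finite class.\<close>
    have "finite (mspace E)"
      using K D(2) E(2) by (auto simp: Met_spanned_fin_def intro: finite_subset[OF _ finite_Plus])
    then have "E \<in> Met_spanned_fin S L"
      using E(1) by (simp add: Met_spanned_fin_def)
    moreover have "isometric_embedding B E (j \<circ> f')" "isometric_embedding C E (j \<circ> g')"
      using isometric_embedding_comp D(3,4) E(3) by blast+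
    moreover have "\<forall>a\<in>mspace A. (j \<circ> f') (f a) = (j \<circ> g') (g a)"
      using D(5) by simp
    ultimately show "\<exists>E\<in>Met_spanned_fin S L :: 'a metric set. \<exists>f' g'.
        isometric_embedding B E f' \<and> isometric_embedding C E g' \<and> (\<forall>a\<in>mspace A. f' (f a) = g' (g a))"
      by blast
  qed
  ultimately show ?thesis
    by (simp add: fraisse_age_def)
qed

end
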